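(* If $\mathcal{A}$ is a recursive star pattern, then $\mathcal{A}$ is potentially nilpotent.
   Context: A (zero-nonzero) pattern of order $n$ is an $n\times n$ matrix $\mathcal{A}$ with entries in $\{*,0\}$, and $Q(\mathcal{A})=\{A\in M_n(\mathbb{R}) : A_{i,j}\neq 0 \Leftrightarrow \mathcal{A}_{i,j}=* \text{ for all } i,j\}$. A pattern $\mathcal{A}$ is potentially nilpotent if $Q(\mathcal{A})$ contains a nilpotent matrix. The star pattern $\mathcal{Z}_s$ is the $s\times s$ pattern whose $(1,1)$ entry is $0$, whose entries $(1,i)$, $(i,1)$ and $(i,i)$ are $*$ for $2\le i\le s$, and whose other entries are $0$. For an $s\times s$ pattern $\mathcal{N}$, $\mathcal{A}_m(\mathcal{N})$ is the $(ms+1)\times(ms+1)$ pattern given in block form by $$\mathcal{A}_m(\mathcal{N})=\begin{bmatrix} 0 & \ell^T & \ell^T & \cdots & \ell^T\\ \ell & \mathcal{N} & 0 & \cdots & 0\\ \ell & 0 & \mathcal{N} & \ddots & \vdots\\ \vdots & \vdots & \ddots & \ddots & 0\\ \ell & 0 & \cdots & 0 & \mathcal{N}\end{bmatrix},$$ with $m$ diagonal blocks $\mathcal{N}$, where $\ell^T=[*\ 0\ \cdots\ 0]$ has length $s$. Recursive star patterns are defined recursively: $\mathcal{A}$ is a recursive star pattern if either $\mathcal{A}=\mathcal{Z}_s$ for some $s\geq 3$, or $\mathcal{A}=\mathcal{A}_m(\mathcal{N})$ for some $m\geq 2$ and some recursive star pattern $\mathcal{N}$ (with root at vertex $1$, i.e.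 the root of $\mathcal{N}$ corresponds to its first row/column, where $\mathcal{N}$ is either a star pattern $\mathcal{Z}_t$ with $t\geq 3$, whose first row and column are the ones with $(1,1)$ entry $0$ and all other entries $*$, or a pattern $\mathcal{A}_{m'}(\mathcal{N}')$ with $m'\geq 2$ and $\mathcal{N}'$ a recursive star pattern, whose first row is $[0\ \ell^T\ \cdots\ \ell^T]$ and whose first column is the transpose of this row, with $\ell^T=[*\ 0\ \cdots\ 0]$ of length equal to the order of $\mathcal{N}'$). *)

theory Defs
  imports Complex_Main "Jordan_Normal_Form.Matrix"
begin

text \<open>Rows and columns are indexed from \<open>0\<close>, as usual for \<^typ>\<open>'a mat\<close>; vertex \<open>1\<close> of the
  literature (the root) is index \<open>0\<close> here.  A pattern of order \<open>n\<close> is an element of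
  \<open>carrier_mat n n\<close> with entries in \<open>entry\<close>.\<close>

datatype entry = Star | Zero

type_synonym pattern = "entry mat"

definition Q :: "pattern \<Rightarrow> real mat set" where
  "Q \<A> = {A \<in> carrier_mat (dim_row \<A>) (dim_col \<A>).
     \<forall>i<dim_row \<A>. \<forall>j<dim_col \<A>. A $$ (i, j) \<noteq> 0 \<longleftrightarrow> \<A> $$ (i, j) = Star}"

definition nilpotent_mat :: "real mat \<Rightarrow> bool" where
  "nilpotent_mat A \<longleftrightarrow> square_mat A \<and> (\<exists>k. A ^\<^sub>m k = 0\<^sub>m (dim_row A) (dim_row A))"

definition potentially_nilpotent :: "pattern \<Rightarrow> bool" where
  "potentially_nilpotent \<A> \<longleftrightarrow> (\<exists>A\<in>Q \<A>. nilpotent_mat A)"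

definition star_pattern :: "nat \<Rightarrow> pattern" where
  "star_pattern s = mat s s (\<lambda>(i, j).
     if i = 0 \<and> j = 0 then Zero
     else if i = 0 \<or> j = 0 \<or> i = j then Star
     else Zero)"

text \<open>For \<open>\<N>\<close> of order \<open>s\<close>, the row (or column) index \<open>i \<ge> 1\<close> of \<open>block_pattern m \<N>\<close> lies in
  block number \<open>(i - 1) div s\<close>, at position \<open>(i - 1) mod s\<close> inside that block.\<close>

definition block_pattern :: "nat \<Rightarrow> pattern \<Rightarrow> pattern" where
  "block_pattern m \<N> = (let s = dim_row \<N> in
     mat (m * s + 1) (m * s + 1) (\<lambda>(i, j).
       if i = 0 \<and> j = 0 then Zero
       else if i = 0 then (if (j - 1) mod s = 0 then Star else Zero)
       else if j = 0 then (if (i - 1) mod s = 0 then Star else Zero)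
       else if (i - 1) div s = (j - 1) div s then \<N> $$ ((i - 1) mod s, (j - 1) mod s)
       else Zero))"

inductive recursive_star_pattern :: "pattern \<Rightarrow> bool" where
  star: "s \<ge> 3 \<Longrightarrow> recursive_star_pattern (star_pattern s)"
| block: "m \<ge> 2 \<Longrightarrow> recursive_star_pattern \<N> \<Longrightarrow> recursive_star_pattern (block_pattern m \<N>)"

end

theory Submission
  imports Defs "HOL-Computational_Algebra.Polynomial"
begin

text \<open>
  The proof is by induction over the recursive construction, with an explicit nilpotent
  realization in both cases.

  For the star pattern of order \<open>s\<close>, take distinct nonzero reals \<open>d\<^sub>i\<close>, one for each of the
  \<open>s - 1\<close> leaves, with sum \<open>0\<close>. In the space of polynomials of degree less than \<open>s\<close>, the
  polynomials \<open>P = \<Prod>\<^sub>j (x - d\<^sub>j)\<close> and \<open>b\<^sub>i = \<Prod>\<^sub>j\<^sub>\<noteq>\<^sub>i (x - d\<^sub>j)\<close> form a basis. Multiplication by \<open>x\<close>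
  modulo \<open>x\<^sup>s\<close> is nilpotent, and its matrix in this basis is a star: \<open>x b\<^sub>i = P + d\<^sub>i b\<^sub>i\<close>, while
  \<open>x P - x\<^sup>s\<close> has degree less than \<open>s - 1\<close> because the \<open>d\<^sub>i\<close> have sum \<open>0\<close>, so Lagrange
  interpolation at the \<open>d\<^sub>i\<close> writes it as a combination of the \<open>b\<^sub>i\<close> alone
  (\<open>lagrange_power_card\<close>). The coefficients are nonzero since the \<open>d\<^sub>i\<close> are. The hypothesis
  \<open>s \<ge> 3\<close> is what allows nonzero \<open>d\<^sub>i\<close> with sum \<open>0\<close>.

  For \<open>m\<close> copies of a pattern joined to a new root, take the same nilpotent realization \<open>B\<close> in
  all blocks, weight \<open>1\<close> on every edge leaving the root downwards, and weights \<open>p\<^sub>k \<noteq> 0\<close> with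
  \<open>\<Sum>\<^sub>k p\<^sub>k = 0\<close> on the edges back; this needs \<open>m \<ge> 2\<close>. The matrix sends a vector with root entry
  \<open>c\<close> and blocks \<open>v\<^sub>k\<close> to the one with root entry \<open>\<Sum>\<^sub>k p\<^sub>k (v\<^sub>k)\<^sub>0\<close> and blocks \<open>c e\<^sub>0 + B v\<^sub>k\<close>. The
  contributions of \<open>c\<close> cancel in \<open>u = \<Sum>\<^sub>k p\<^sub>k v\<^sub>k\<close>, so \<open>u\<close> is simply multiplied by \<open>B\<close> and dies
  out. From then on the root entry, which is the first entry of the previous \<open>u\<close>, vanishes,
  every block is multiplied by \<open>B\<close>, and the blocks die out as well (\<open>nilpotent_block_mat\<close>).
\<close>

section \<open>Nilpotency through the action on vectors\<close>

lemma index_mult_mat_vec_sum: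
  fixes A :: "'a::semiring_0 mat"
  assumes "A \<in> carrier_mat n n" "v \<in> carrier_vec n" "i < n"
  shows "(A *\<^sub>v v) $ i = (\<Sum>j<n. A $$ (i, j) * v $ j)"
  using assms by (auto simp: scalar_prod_def atLeast0LessThan intro!: sum.cong)

lemma pow_mat_mult_vec_Suc:
  fixes A :: "'a::semiring_1 mat"
  assumes "A \<in> carrier_mat n n" "v \<in> carrier_vec n"
  shows "(A ^\<^sub>m Suc k) *\<^sub>v v = (A ^\<^sub>m k) *\<^sub>v (A *\<^sub>v v)"
  using assms assoc_mult_mat_vec[of "A ^\<^sub>m k" n n A n v] by simp

lemma pow_mat_mult_vec_add:
  fixes A :: "'a::semiring_1 mat"
  assumes "A \<in> carrier_mat n n" "v \<in> carrier_vec n"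
  shows "(A ^\<^sub>m (j + k)) *\<^sub>v v = (A ^\<^sub>m j) *\<^sub>v ((A ^\<^sub>m k) *\<^sub>v v)"
  using assms(2)
proof (induction k arbitrary: v)
  case 0
  then show ?case using assms(1) by simp
next
  case (Suc k)
  have "A *\<^sub>v v \<in> carrier_vec n"
    using assms(1) Suc.prems by simp
  then show ?case
    using Suc.IH[of "A *\<^sub>v v"] pow_mat_mult_vec_Suc[OF assms(1) Suc.prems]
    by (simp del: pow_mat.simps)
qed

lemma nilpotent_matI:
  assumes A: "A \<in> carrier_mat n n"
    and zero: "\<And>v. v \<in> carrier_vec n \<Longrightarrow> (A ^\<^sub>m k) *\<^sub>v v = 0\<^sub>v n"
  shows "nilpotent_mat A"
proof -
  have Ak: "A ^\<^sub>m k \<in> carrier_mat n n"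
    using A by simp
  have "A ^\<^sub>m k = 0\<^sub>m n n"
  proof (rule eq_matI)
    fix i j assume ij: "i < dim_row (0\<^sub>m n n :: real mat)" "j < dim_col (0\<^sub>m n n :: real mat)"
    have "(A ^\<^sub>m k) $$ (i, j) = ((A ^\<^sub>m k) *\<^sub>v unit_vec n j) $ i"
      using ij A by simp
    then show "(A ^\<^sub>m k) $$ (i, j) = 0\<^sub>m n n $$ (i, j)"
      using ij zero[of "unit_vec n j"] by simp
  qed (use Ak in auto)
  then show ?thesis
    using A unfolding nilpotent_mat_def by auto
qed

text \<open>In the argument for block patterns only part of a vector is followed at a time: the part
  \<open>f v\<close> evolves under \<open>B\<close> while \<open>v\<close> evolves under \<open>A\<close>, possibly only on an invariant set \<open>S\<close>.\<close>

lemma pow_mat_intertwine: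
  fixes A B :: "'a::semiring_1 mat"
  assumes A: "A \<in> carrier_mat n n" and B: "B \<in> carrier_mat r r"
    and S: "S \<subseteq> carrier_vec n" and f: "\<And>v. v \<in> S \<Longrightarrow> f v \<in> carrier_vec r"
    and inv: "\<And>v. v \<in> S \<Longrightarrow> A *\<^sub>v v \<in> S"
    and step: "\<And>v. v \<in> S \<Longrightarrow> f (A *\<^sub>v v) = B *\<^sub>v f v"
    and v: "v \<in> S"
  shows "(A ^\<^sub>m k) *\<^sub>v v \<in> S \<and> f ((A ^\<^sub>m k) *\<^sub>v v) = (B ^\<^sub>m k) *\<^sub>v f v"
  using v
proof (induction k arbitrary: v)
  case 0
  then show ?case using A B S f[OF 0] by auto
next
  case (Suc k)
  show ?case
    using Suc.IH[OF inv[OF Suc.prems]] step[OF Suc.prems] S Suc.prems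
      pow_mat_mult_vec_Suc[OF A, of v k] pow_mat_mult_vec_Suc[OF B f[OF Suc.prems], of k]
    by auto
qed

section \<open>Star patterns\<close>

definition node_poly :: "('i \<Rightarrow> real) \<Rightarrow> 'i set \<Rightarrow> real poly" where
  "node_poly d I = (\<Prod>i\<in>I. [:- d i, 1:])"

lemma poly_node_poly: "poly (node_poly d I) x = (\<Prod>i\<in>I. x - d i)"
  by (simp add: node_poly_def poly_prod)

lemma degree_node_poly: "degree (node_poly d I) = card I"
  unfolding node_poly_def by (subst degree_prod_sum_eq) auto

lemma coeff_card_node_poly: "coeff (node_poly d I) (card I) = 1"
  using lead_coeff_prod[of "\<lambda>i. [:- d i, 1:]" I]
  by (simp flip: node_poly_def add: degree_node_poly)

text \<open>Up to sign, the sum of the roots is the second highest coefficient. The factor \<open>x\<close>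
  (the \<open>pCons 0\<close>) shifts the index from \<open>card I - 1\<close> to \<open>card I\<close>, so that the empty set is no
  exception.\<close>

lemma coeff_pCons_node_poly:
  "finite I \<Longrightarrow> coeff (pCons 0 (node_poly d I)) (card I) = - (\<Sum>i\<in>I. d i)"
proof (induction I rule: finite_induct)
  case (insert i I)
  have "node_poly d (insert i I) = pCons 0 (node_poly d I) - smult (d i) (node_poly d I)"
    using insert.hyps by (simp add: node_poly_def)
  then show ?case
    using insert by (simp add: coeff_card_node_poly)
qed (simp add: node_poly_def)

lemma node_poly_remove:
  assumes "finite I" "i \<in> I"
  shows "pCons 0 (node_poly d (I - {i})) = node_poly d I + smult (d i) (node_poly d (I - {i}))"
proof -
  have "node_poly d I = [:- d i, 1:] * node_poly d (I - {i})"
    unfolding node_poly_def using assms by (rule prod.remove)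
  then show ?thesis by simp
qed

text \<open>At the node \<open>d i\<close> every summand except the \<open>i\<close>-th has a root. This evaluates Lagrange
  interpolants, and for distinct nodes it also yields the linear independence of
  the polynomials \<open>b\<^sub>i\<close>.\<close>

lemma poly_sum_node_poly:
  assumes I: "finite I" and i: "i \<in> I"
  shows "poly (\<Sum>j\<in>I. smult (c j) (node_poly d (I - {j}))) (d i)
       = c i * poly (node_poly d (I - {i})) (d i)"
proof -
  have "poly (\<Sum>j\<in>I. smult (c j) (node_poly d (I - {j}))) (d i)
      = (\<Sum>j\<in>I. if j = i then c i * poly (node_poly d (I - {i})) (d i) else 0)"
    unfolding poly_sum using I i by (intro sum.cong) (auto simp: poly_node_poly)
  then show ?thesis
    using I i by simp
qed

lemma poly_node_poly_remove_neq_0: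
  assumes "finite I" "i \<in> I" "inj_on d I"
  shows "poly (node_poly d (I - {i})) (d i) \<noteq> 0"
  using assms by (auto simp: poly_node_poly inj_on_def)

lemma degree_sum_node_poly:
  assumes "finite I" "I \<noteq> {}"
  shows "degree (\<Sum>j\<in>I. smult (c j) (node_poly d (I - {j}))) < card I"
proof -
  have "0 < card I" using assms by (simp add: card_gt_0_iff)
  moreover have "degree (\<Sum>j\<in>I. smult (c j) (node_poly d (I - {j}))) \<le> card I - 1"
    using assms by (intro degree_sum_le) (auto intro: order.trans[OF degree_smult_le] simp: degree_node_poly)
  ultimately show ?thesis by simp
qed

text \<open>The right-hand side is \<open>x P - x\<^sup>n\<^sup>+\<^sup>1\<close> with \<open>n = card I\<close> nodes. Its two highest
  coefficients vanish, the second one because the nodes have sum \<open>0\<close>; hence it has degree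
  less than \<open>n\<close> and equals its interpolant at the nodes, where it takes the values
  \<open>- d\<^sub>i\<^sup>n\<^sup>+\<^sup>1\<close>.\<close>

lemma lagrange_power_card:
  assumes I: "finite I" "I \<noteq> {}" and inj: "inj_on d I" and sum0: "(\<Sum>i\<in>I. d i) = 0"
  shows "(\<Sum>i\<in>I. smult (- (d i ^ Suc (card I)) / poly (node_poly d (I - {i})) (d i))
            (node_poly d (I - {i})))
       = pCons 0 (node_poly d I) - monom 1 (Suc (card I))"
    (is "?L = ?R")
proof (rule poly_eqI_degree[of "d ` I"])
  have card: "card (d ` I) = card I" "0 < card I"
    using I by (simp_all add: card_image[OF inj] card_gt_0_iff)
  show "degree ?L < card (d ` I)"
    unfolding card by (rule degree_sum_node_poly[OF I])
  have "coeff ?R k = 0" if "k > card I - 1" for k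
  proof -
    consider "k = card I" | "k = Suc (card I)" | "k > Suc (card I)"
      using \<open>k > card I - 1\<close> by linarith
    then show ?thesis
    proof cases
      case 1
      then show ?thesis using coeff_pCons_node_poly[OF I(1), of d] sum0 by simp
    next
      case 2
      then show ?thesis by (simp add: coeff_card_node_poly)
    next
      case 3
      then show ?thesis
        by (auto simp: coeff_pCons degree_node_poly split: nat.split intro!: coeff_eq_0)
    qed
  qed
  then have "degree ?R \<le> card I - 1"
    by (intro degree_le) auto
  then show "degree ?R < card (d ` I)"
    using card by simp
next
  fix x assume "x \<in> d ` I"
  then obtain i where i: "i \<in> I" "x = d i" by auto
  have "poly (node_poly d I) (d i) = 0"
    using I i by (auto simp: poly_node_poly)
  moreover have "poly ?L (d i) = - (d i ^ Suc (card I)) / poly (node_poly d (I - {i})) (d i)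
      * poly (node_poly d (I - {i})) (d i)"
    by (rule poly_sum_node_poly[OF I(1) i(1)])
  ultimately show "poly ?L x = poly ?R x"
    using poly_node_poly_remove_neq_0[OF I(1) i(1) inj]
    by (simp add: i(2) poly_monom del: power_Suc)
qed

lemma smult_sum_right: "smult c (\<Sum>i\<in>I. f i) = (\<Sum>i\<in>I. smult c (f i))"
  using sum_distrib_left[of "[:c:]" f I] by simp

lemma pCons_0_sum:
  fixes f :: "'i \<Rightarrow> 'a::comm_semiring_1 poly"
  shows "pCons 0 (\<Sum>i\<in>I. f i) = (\<Sum>i\<in>I. pCons 0 (f i))"
  using sum_distrib_left[of "[:0, 1:]" f I] by simp

definition star_mat :: "nat \<Rightarrow> (nat \<Rightarrow> real) \<Rightarrow> (nat \<Rightarrow> real) \<Rightarrow> real mat" where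
  "star_mat s p d = mat s s (\<lambda>(i, j).
     if i = 0 \<and> j = 0 then 0
     else if i = 0 then 1
     else if j = 0 then p i
     else if i = j then d i
     else 0)"

lemma star_mat_carrier: "star_mat s p d \<in> carrier_mat s s"
  by (simp add: star_mat_def)

lemma star_mat_mult_vec_0:
  assumes v: "v \<in> carrier_vec s" and "0 < s"
  shows "(star_mat s p d *\<^sub>v v) $ 0 = (\<Sum>j\<in>{1..<s}. v $ j)"
proof -
  have "{..<s} = insert 0 {1..<s}"
    using \<open>0 < s\<close> by auto
  then show ?thesis
    unfolding index_mult_mat_vec_sum[OF star_mat_carrier v \<open>0 < s\<close>]
    using \<open>0 < s\<close> by (simp add: star_mat_def)
qed

lemma star_mat_mult_vec_leaf:
  assumes v: "v \<in> carrier_vec s" and i: "i \<in> {1..<s}"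
  shows "(star_mat s p d *\<^sub>v v) $ i = p i * v $ 0 + d i * v $ i"
proof -
  have "i < s" using i by simp
  have "(\<Sum>j<s. star_mat s p d $$ (i, j) * v $ j)
      = (\<Sum>j<s. (if j = 0 then p i * v $ 0 else 0) + (if j = i then d i * v $ i else 0))"
    using i by (intro sum.cong) (auto simp: star_mat_def)
  then show ?thesis
    unfolding index_mult_mat_vec_sum[OF star_mat_carrier v \<open>i < s\<close>]
    using i by (simp add: sum.distrib)
qed

text \<open>The polynomial whose coordinates in the basis \<open>P\<close>, \<open>b\<^sub>i\<close> of the introduction are the
  entries of \<open>v\<close>.\<close>

definition star_vec_poly :: "nat \<Rightarrow> (nat \<Rightarrow> real) \<Rightarrow> real vec \<Rightarrow> real poly" where
  "star_vec_poly s d v = smult (v $ 0) (node_poly d {1..<s})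
     + (\<Sum>i\<in>{1..<s}. smult (v $ i) (node_poly d ({1..<s} - {i})))"

lemma degree_star_vec_poly:
  assumes "2 \<le> s"
  shows "degree (star_vec_poly s d v) < s"
proof -
  have "degree (smult (v $ 0) (node_poly d {1..<s})) \<le> s - 1"
    by (rule order.trans[OF degree_smult_le]) (simp add: degree_node_poly)
  moreover have "degree (\<Sum>i\<in>{1..<s}. smult (v $ i) (node_poly d ({1..<s} - {i}))) \<le> s - 1"
    using degree_sum_node_poly[of "{1..<s}" "\<lambda>i. v $ i" d] assms by simp
  ultimately have "degree (star_vec_poly s d v) \<le> s - 1"
    unfolding star_vec_poly_def by (rule degree_add_le)
  then show ?thesis using assms by simp
qed

lemma star_vec_poly_eq_0:
  assumes v: "v \<in> carrier_vec s" and inj: "inj_on d {1..<s}" and zero: "star_vec_poly s d v = 0"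
  shows "v = 0\<^sub>v s"
proof -
  have leaf: "v $ i = 0" if i: "i \<in> {1..<s}" for i
  proof -
    have "poly (node_poly d {1..<s}) (d i) = 0"
      using i by (auto simp: poly_node_poly)
    moreover have "poly (star_vec_poly s d v) (d i) = 0"
      using zero by simp
    ultimately have "v $ i * poly (node_poly d ({1..<s} - {i})) (d i) = 0"
      unfolding star_vec_poly_def poly_add poly_sum_node_poly[OF finite_atLeastLessThan i] by simp
    then show ?thesis
      using poly_node_poly_remove_neq_0[OF finite_atLeastLessThan i inj] by simp
  qed
  then have "smult (v $ 0) (node_poly d {1..<s}) = 0"
    using zero by (simp add: star_vec_poly_def)
  then have "v $ 0 = 0"
    using coeff_card_node_poly[of d "{1..<s}"] by auto
  then have "v $ i = 0" if "i < s" for i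
    using leaf[of i] that by (cases "i = 0") auto
  then show ?thesis
    using v by (intro eq_vecI) auto
qed

text \<open>The star matrix is multiplication by \<open>x\<close> modulo \<open>x\<^sup>s\<close>; the monomial on the right is the
  multiple of \<open>x\<^sup>s\<close> that the reduction removes.\<close>

lemma star_vec_poly_mult:
  assumes s: "2 \<le> s" and inj: "inj_on d {1..<s}" and sum0: "(\<Sum>i\<in>{1..<s}. d i) = 0"
    and p: "\<And>i. i \<in> {1..<s} \<Longrightarrow> p i = - (d i ^ s) / poly (node_poly d ({1..<s} - {i})) (d i)"
    and v: "v \<in> carrier_vec s"
  shows "star_vec_poly s d (star_mat s p d *\<^sub>v v)
       = pCons 0 (star_vec_poly s d v) - monom (v $ 0) s"
proof -
  let ?I = "{1..<s}"
  let ?P = "node_poly d ?I" and ?b = "\<lambda>i. node_poly d (?I - {i})"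
  have lag: "(\<Sum>i\<in>?I. smult (p i) (?b i)) = pCons 0 ?P - monom 1 s"
    using lagrange_power_card[of ?I d] inj sum0 p s by simp
  have "star_vec_poly s d (star_mat s p d *\<^sub>v v)
      = smult (\<Sum>j\<in>?I. v $ j) ?P + (\<Sum>i\<in>?I. smult (p i * v $ 0 + d i * v $ i) (?b i))"
    using s v unfolding star_vec_poly_def
    by (simp add: star_mat_mult_vec_0 star_mat_mult_vec_leaf)
  also have "\<dots> = smult (\<Sum>j\<in>?I. v $ j) ?P + smult (v $ 0) (\<Sum>i\<in>?I. smult (p i) (?b i))
      + (\<Sum>i\<in>?I. smult (v $ i) (smult (d i) (?b i)))"
    by (simp add: smult_add_left sum.distrib smult_sum_right mult.commute)
  also have "\<dots> = smult (v $ 0) (\<Sum>i\<in>?I. smult (p i) (?b i))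
      + (\<Sum>i\<in>?I. smult (v $ i) (?P + smult (d i) (?b i)))"
    by (simp add: smult_sum smult_add_right sum.distrib)
  also have "(\<Sum>i\<in>?I. smult (v $ i) (?P + smult (d i) (?b i)))
      = (\<Sum>i\<in>?I. smult (v $ i) (pCons 0 (?b i)))"
    by (intro sum.cong) (simp_all add: node_poly_remove)
  also have "\<dots> = pCons 0 (\<Sum>i\<in>?I. smult (v $ i) (?b i))"
    by (simp add: pCons_0_sum)
  finally have "star_vec_poly s d (star_mat s p d *\<^sub>v v)
      = smult (v $ 0) (pCons 0 ?P - monom 1 s) + pCons 0 (\<Sum>i\<in>?I. smult (v $ i) (?b i))"
    unfolding lag .
  moreover have "pCons 0 (star_vec_poly s d v)
      = smult (v $ 0) (pCons 0 ?P) + pCons 0 (\<Sum>i\<in>?I. smult (v $ i) (?b i))"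
    by (simp add: star_vec_poly_def)
  ultimately show ?thesis
    by (simp only: smult_diff_right smult_monom mult_1_right)
qed

lemma nilpotent_star_mat:
  assumes s: "2 \<le> s" and inj: "inj_on d {1..<s}" and sum0: "(\<Sum>i\<in>{1..<s}. d i) = 0"
    and p: "\<And>i. i \<in> {1..<s} \<Longrightarrow> p i = - (d i ^ s) / poly (node_poly d ({1..<s} - {i})) (d i)"
  shows "nilpotent_mat (star_mat s p d)"
proof (rule nilpotent_matI[OF star_mat_carrier])
  let ?A = "star_mat s p d" and ?T = "star_vec_poly s d"
  fix v :: "real vec" assume v: "v \<in> carrier_vec s"
  \<comment> \<open>Applying the matrix \<open>k\<close> times multiplies by \<open>x\<^sup>k\<close> modulo \<open>x\<^sup>s\<close>; the case \<open>k = s\<close> is used.\<close>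
  have "monom 1 s dvd ?T ((?A ^\<^sub>m k) *\<^sub>v w) - monom 1 k * ?T w" if "w \<in> carrier_vec s" for k w
    using that
  proof (induction k arbitrary: w)
    case 0
    then show ?case using star_mat_carrier[of s p d] by (simp add: monom_0)
  next
    case (Suc k)
    have Aw: "?A *\<^sub>v w \<in> carrier_vec s"
      using star_mat_carrier[of s p d] Suc.prems by simp
    have TA: "?T (?A *\<^sub>v w) = pCons 0 (?T w) - monom (w $ 0) s"
      by (rule star_vec_poly_mult[OF s inj sum0 p Suc.prems])
    have "?T ((?A ^\<^sub>m Suc k) *\<^sub>v w) - monom 1 (Suc k) * ?T w
        = (?T ((?A ^\<^sub>m k) *\<^sub>v (?A *\<^sub>v w)) - monom 1 k * ?T (?A *\<^sub>v w))
          - monom 1 s * monom (w $ 0) k"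
      unfolding pow_mat_mult_vec_Suc[OF star_mat_carrier Suc.prems] TA
      by (simp add: algebra_simps mult_monom monom_Suc)
    then show ?case
      using Suc.IH[OF Aw] by simp
  qed
  from this[OF v, of s] have "monom 1 s dvd ?T ((?A ^\<^sub>m s) *\<^sub>v v)"
    by (simp add: dvd_diff_left_iff)
  moreover have "degree (?T ((?A ^\<^sub>m s) *\<^sub>v v)) < degree (monom (1::real) s)"
    using degree_star_vec_poly[OF s] by (simp add: degree_monom_eq)
  ultimately have "?T ((?A ^\<^sub>m s) *\<^sub>v v) = 0"
    using dvd_imp_degree_le by fastforce
  moreover have "(?A ^\<^sub>m s) *\<^sub>v v \<in> carrier_vec s"
    using pow_carrier_mat[OF star_mat_carrier[of s p d], of s] v by simp
  ultimately show "(?A ^\<^sub>m s) *\<^sub>v v = 0\<^sub>v s"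
    using star_vec_poly_eq_0[OF _ inj] by blast
qed

text \<open>The nodes are \<open>1, \<dots>, s - 2\<close> and minus their sum.\<close>

lemma exists_nonzero_nodes_sum_0:
  assumes "3 \<le> s"
  obtains d :: "nat \<Rightarrow> real"
  where "inj_on d {1..<s}" "\<And>i. i \<in> {1..<s} \<Longrightarrow> d i \<noteq> 0" "(\<Sum>i\<in>{1..<s}. d i) = 0"
proof -
  define c where "c = (\<Sum>i\<in>{1..<s - 1}. real i)"
  define d where "d i = (if i = s - 1 then - c else real i)" for i
  have split: "{1..<s} = insert (s - 1) {1..<s - 1}"
    using assms by auto
  have "c > 0"
    unfolding c_def using assms by (intro sum_pos) auto
  have "inj_on d {1..<s}"
    using \<open>c > 0\<close> by (auto simp: inj_on_def d_def)
  moreover have "d i \<noteq> 0" if "i \<in> {1..<s}" for i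
    using that \<open>c > 0\<close> by (auto simp: d_def)
  moreover have "(\<Sum>i\<in>{1..<s}. d i) = 0"
    unfolding split by (simp add: d_def c_def)
  ultimately show ?thesis
    by (rule that)
qed

lemma star_pattern_potentially_nilpotent:
  assumes s: "3 \<le> s"
  shows "potentially_nilpotent (star_pattern s)"
proof -
  obtain d :: "nat \<Rightarrow> real" where inj: "inj_on d {1..<s}"
    and d0: "\<And>i. i \<in> {1..<s} \<Longrightarrow> d i \<noteq> 0" and sum0: "(\<Sum>i\<in>{1..<s}. d i) = 0"
    using exists_nonzero_nodes_sum_0[OF s] by metis
  define p where "p i = - (d i ^ s) / poly (node_poly d ({1..<s} - {i})) (d i)" for i
  have "p i \<noteq> 0" if "i \<in> {1..<s}" for i
    using d0[OF that] poly_node_poly_remove_neq_0[OF finite_atLeastLessThan that inj]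
    by (simp add: p_def)
  then have "star_mat s p d \<in> Q (star_pattern s)"
    using d0 by (auto simp: Q_def star_pattern_def star_mat_def)
  moreover have "nilpotent_mat (star_mat s p d)"
    using s by (intro nilpotent_star_mat[OF _ inj sum0]) (simp_all add: p_def)
  ultimately show ?thesis
    unfolding potentially_nilpotent_def by blast
qed

section \<open>Block patterns\<close>

definition block_mat :: "nat \<Rightarrow> (nat \<Rightarrow> real) \<Rightarrow> real mat \<Rightarrow> real mat" where
  "block_mat m p B = (let s = dim_row B in
     mat (m * s + 1) (m * s + 1) (\<lambda>(i, j).
       if i = 0 \<and> j = 0 then 0
       else if i = 0 then (if (j - 1) mod s = 0 then p ((j - 1) div s) else 0)
       else if j = 0 then (if (i - 1) mod s = 0 then 1 else 0)
       else if (i - 1) div s = (j - 1) div s then B $$ ((i - 1) mod s, (j - 1) mod s)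
       else 0))"

lemma block_mat_carrier: "B \<in> carrier_mat s s \<Longrightarrow> block_mat m p B \<in> carrier_mat (m * s + 1) (m * s + 1)"
  by (simp add: block_mat_def Let_def)

lemma block_index_less: "k < m \<Longrightarrow> i < s \<Longrightarrow> k * s + i < m * (s::nat)"
  using mult_le_mono1[of "Suc k" m s] by simp

lemma sum_block_index:
  fixes f :: "nat \<Rightarrow> real"
  shows "(\<Sum>j<m * s + 1. f j) = f 0 + (\<Sum>k<m. \<Sum>i<s. f (Suc (k * s + i)))"
proof -
  have "(\<Sum>j<m * s + 1. f j) = f 0 + (\<Sum>j<m * s. f (Suc j))"
    by (simp add: sum.lessThan_Suc_shift del: sum.lessThan_Suc)
  also have "(\<Sum>j<m * s. f (Suc j)) = (\<Sum>k<m. \<Sum>j\<in>{k * s..<k * s + s}. f (Suc j))"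
    by (rule sum.nat_group[symmetric])
  also have "\<dots> = (\<Sum>k<m. \<Sum>i<s. f (Suc (k * s + i)))"
  proof (rule sum.cong[OF refl])
    fix k
    show "(\<Sum>j\<in>{k * s..<k * s + s}. f (Suc j)) = (\<Sum>i<s. f (Suc (k * s + i)))"
      using sum.shift_bounds_nat_ivl[of "\<lambda>j. f (Suc j)" 0 "k * s" s]
      by (simp add: atLeast0LessThan add.commute)
  qed
  finally show ?thesis .
qed

definition vec_block :: "nat \<Rightarrow> nat \<Rightarrow> real vec \<Rightarrow> real vec" where
  "vec_block s k v = vec s (\<lambda>i. v $ Suc (k * s + i))"

definition weighted_block_sum :: "nat \<Rightarrow> nat \<Rightarrow> (nat \<Rightarrow> real) \<Rightarrow> real vec \<Rightarrow> real vec" where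
  "weighted_block_sum s m p v = vec s (\<lambda>i. \<Sum>k<m. p k * vec_block s k v $ i)"

lemma weighted_block_sum_carrier: "weighted_block_sum s m p v \<in> carrier_vec s"
  by (simp add: weighted_block_sum_def)

lemma vec_eq_0_blocks:
  assumes v: "v \<in> carrier_vec (m * s + 1)" and root: "v $ 0 = 0"
    and blocks: "\<And>k. k < m \<Longrightarrow> vec_block s k v = 0\<^sub>v s"
  shows "v = 0\<^sub>v (m * s + 1)"
proof (rule eq_vecI)
  fix i assume "i < dim_vec (0\<^sub>v (m * s + 1) :: real vec)"
  then have i: "i < m * s + 1" by simp
  show "v $ i = 0\<^sub>v (m * s + 1) $ i"
  proof (cases i)
    case (Suc j)
    have j: "j < m * s" using i Suc by simp
    then have "0 < s" by (cases s) auto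
    have k: "j div s < m"
      using j by (simp add: less_mult_imp_div_less)
    have "vec_block s (j div s) v $ (j mod s) = v $ i"
      using \<open>0 < s\<close> by (simp add: vec_block_def Suc)
    then show ?thesis
      using blocks[OF k] i \<open>0 < s\<close> by simp
  qed (use root i in simp)
qed (use v in simp)

lemma block_mat_mult_vec_root:
  assumes B: "B \<in> carrier_mat s s" and s: "0 < s" and v: "v \<in> carrier_vec (m * s + 1)"
  shows "(block_mat m p B *\<^sub>v v) $ 0 = weighted_block_sum s m p v $ 0"
proof -
  have entry: "block_mat m p B $$ (0, Suc (k * s + i)) = (if i = 0 then p k else 0)"
    if "k < m" "i < s" for k i
    using that B block_index_less[OF that] by (simp add: block_mat_def Let_def)
  have root: "0 < m * s + 1" by simp
  have "(block_mat m p B *\<^sub>v v) $ 0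
      = (\<Sum>k<m. \<Sum>i<s. block_mat m p B $$ (0, Suc (k * s + i)) * v $ Suc (k * s + i))"
    unfolding index_mult_mat_vec_sum[OF block_mat_carrier[OF B] v root] sum_block_index
    using B by (simp add: block_mat_def Let_def)
  also have "\<dots> = (\<Sum>k<m. \<Sum>i<s. if i = 0 then p k * v $ Suc (k * s) else 0)"
    by (intro sum.cong refl) (simp add: entry)
  finally show ?thesis
    using s by (simp add: weighted_block_sum_def vec_block_def)
qed

lemma vec_block_block_mat:
  assumes B: "B \<in> carrier_mat s s" and v: "v \<in> carrier_vec (m * s + 1)" and k: "k < m"
  shows "vec_block s k (block_mat m p B *\<^sub>v v) = v $ 0 \<cdot>\<^sub>v unit_vec s 0 + B *\<^sub>v vec_block s k v"
proof (rule eq_vecI)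
  fix i assume "i < dim_vec (v $ 0 \<cdot>\<^sub>v unit_vec s 0 + B *\<^sub>v vec_block s k v)"
  then have i: "i < s" using B by simp
  let ?r = "Suc (k * s + i)"
  have r: "?r < m * s + 1" using block_index_less[OF k i] by simp
  have entry: "block_mat m p B $$ (?r, Suc (l * s + j)) = (if l = k then B $$ (i, j) else 0)"
    if "l < m" "j < s" for l j
    using that i B block_index_less[OF that] block_index_less[OF k i]
    by (simp add: block_mat_def Let_def)
  have root: "block_mat m p B $$ (?r, 0) = (if i = 0 then 1 else 0)"
    using i B block_index_less[OF k i] by (simp add: block_mat_def Let_def)
  have "vec_block s k (block_mat m p B *\<^sub>v v) $ i = (block_mat m p B *\<^sub>v v) $ ?r"
    using i by (simp add: vec_block_def)
  also have "\<dots> = (if i = 0 then v $ 0 else 0)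
      + (\<Sum>l<m. \<Sum>j<s. block_mat m p B $$ (?r, Suc (l * s + j)) * v $ Suc (l * s + j))"
    unfolding index_mult_mat_vec_sum[OF block_mat_carrier[OF B] v r] sum_block_index
    by (simp add: root)
  also have "(\<Sum>l<m. \<Sum>j<s. block_mat m p B $$ (?r, Suc (l * s + j)) * v $ Suc (l * s + j))
      = (\<Sum>l<m. if l = k then \<Sum>j<s. B $$ (i, j) * v $ Suc (k * s + j) else 0)"
    by (intro sum.cong refl) (auto simp: entry intro!: sum.neutral)
  also have "\<dots> = (B *\<^sub>v vec_block s k v) $ i"
    using k index_mult_mat_vec_sum[OF B _ i, of "vec_block s k v"] by (simp add: vec_block_def)
  finally show "vec_block s k (block_mat m p B *\<^sub>v v) $ i
      = (v $ 0 \<cdot>\<^sub>v unit_vec s 0 + B *\<^sub>v vec_block s k v) $ i"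
    using i B by (simp add: unit_vec_def)
qed (use B in \<open>simp add: vec_block_def\<close>)

text \<open>The root entry enters all blocks equally, so it is weighted by \<open>\<Sum>\<^sub>k p\<^sub>k = 0\<close> and
  disappears.\<close>

lemma weighted_block_sum_block_mat:
  assumes B: "B \<in> carrier_mat s s" and v: "v \<in> carrier_vec (m * s + 1)"
    and p: "(\<Sum>k<m. p k) = 0"
  shows "weighted_block_sum s m p (block_mat m p B *\<^sub>v v) = B *\<^sub>v weighted_block_sum s m p v"
proof (rule eq_vecI)
  fix i assume "i < dim_vec (B *\<^sub>v weighted_block_sum s m p v)"
  then have i: "i < s" using B by simp
  have vb: "vec_block s k v \<in> carrier_vec s" for k by (simp add: vec_block_def)
  have "weighted_block_sum s m p (block_mat m p B *\<^sub>v v) $ i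
      = (\<Sum>k<m. p k * (v $ 0 * unit_vec s 0 $ i + (\<Sum>j<s. B $$ (i, j) * vec_block s k v $ j)))"
    using i B index_mult_mat_vec_sum[OF B vb i]
    by (simp add: weighted_block_sum_def vec_block_block_mat[OF B v] del: index_mult_mat_vec)
  also have "\<dots> = (\<Sum>k<m. p k) * (v $ 0 * unit_vec s 0 $ i)
      + (\<Sum>k<m. \<Sum>j<s. B $$ (i, j) * (p k * vec_block s k v $ j))"
    by (simp add: distrib_left sum.distrib sum_distrib_left sum_distrib_right mult.left_commute)
  also have "\<dots> = (\<Sum>j<s. B $$ (i, j) * (\<Sum>k<m. p k * vec_block s k v $ j))"
    unfolding p by (subst sum.swap) (simp add: sum_distrib_left)
  also have "\<dots> = (B *\<^sub>v weighted_block_sum s m p v) $ i"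
    using index_mult_mat_vec_sum[OF B _ i, of "weighted_block_sum s m p v"]
    by (simp add: weighted_block_sum_def)
  finally show "weighted_block_sum s m p (block_mat m p B *\<^sub>v v) $ i
      = (B *\<^sub>v weighted_block_sum s m p v) $ i" .
qed (use B in \<open>simp add: weighted_block_sum_def\<close>)

text \<open>If \<open>B\<^sup>k = 0\<close>, then \<open>k\<close> applications kill the weighted block sum, one more kills the root
  entry, and another \<open>k\<close> kill the blocks.\<close>

lemma nilpotent_block_mat:
  assumes B: "B \<in> carrier_mat s s" and s: "0 < s" and nil: "nilpotent_mat B"
    and p: "(\<Sum>k<m. p k) = 0"
  shows "nilpotent_mat (block_mat m p B)"
proof -
  let ?A = "block_mat m p B" and ?n = "m * s + 1" and ?u = "weighted_block_sum s m p"
  have A: "?A \<in> carrier_mat ?n ?n"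
    using B by (rule block_mat_carrier)
  have Av: "?A *\<^sub>v v \<in> carrier_vec ?n" if "v \<in> carrier_vec ?n" for v
    using A that by simp
  obtain k where k: "B ^\<^sub>m k = 0\<^sub>m s s"
    using nil B unfolding nilpotent_mat_def by auto
  have Bk: "(B ^\<^sub>m k) *\<^sub>v w = 0\<^sub>v s" if "w \<in> carrier_vec s" for w
    using that unfolding k by (intro eq_vecI) (auto simp: scalar_prod_def)
  have B0: "B *\<^sub>v 0\<^sub>v s = 0\<^sub>v s"
    using B by (intro eq_vecI) (auto simp: scalar_prod_def)
  \<comment> \<open>On this invariant subspace the root no longer feeds the blocks, which evolve separately.\<close>
  define S where "S = {v \<in> carrier_vec ?n. v $ 0 = 0 \<and> ?u v = 0\<^sub>v s}"
  have inv: "?A *\<^sub>v v \<in> S" if "v \<in> carrier_vec ?n" "?u v = 0\<^sub>v s" for v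
    using that Av[OF that(1)] B s
    by (simp add: S_def block_mat_mult_vec_root weighted_block_sum_block_mat[OF B _ p] B0 del: index_mult_mat_vec)
  have "(?A ^\<^sub>m (k + Suc k)) *\<^sub>v v = 0\<^sub>v ?n" if v: "v \<in> carrier_vec ?n" for v
  proof -
    define w where "w = (?A ^\<^sub>m Suc k) *\<^sub>v v"
    have "(?A ^\<^sub>m k) *\<^sub>v v \<in> carrier_vec ?n \<and> ?u ((?A ^\<^sub>m k) *\<^sub>v v) = (B ^\<^sub>m k) *\<^sub>v ?u v"
      by (rule pow_mat_intertwine[OF A B])
        (use v Av in \<open>auto simp: weighted_block_sum_block_mat[OF B _ p] weighted_block_sum_carrier\<close>)
    then have "?A *\<^sub>v ((?A ^\<^sub>m k) *\<^sub>v v) \<in> S"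
      by (intro inv) (auto simp: Bk weighted_block_sum_carrier)
    moreover have "w = ?A *\<^sub>v ((?A ^\<^sub>m k) *\<^sub>v v)"
      using pow_mat_mult_vec_add[OF A v, of 1 k] A by (simp add: w_def)
    ultimately have w: "w \<in> S"
      by simp
    have blk: "(?A ^\<^sub>m k) *\<^sub>v w \<in> S \<and> vec_block s l ((?A ^\<^sub>m k) *\<^sub>v w) = (B ^\<^sub>m k) *\<^sub>v vec_block s l w"
      if "l < m" for l
    proof (rule pow_mat_intertwine[OF A B _ _ _ _ w])
      fix z assume "z \<in> S"
      then have z: "z \<in> carrier_vec ?n" "z $ 0 = 0" "?u z = 0\<^sub>v s"
        by (auto simp: S_def)
      show "?A *\<^sub>v z \<in> S"
        using z by (intro inv)
      have "B *\<^sub>v vec_block s l z \<in> carrier_vec s"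
        using B by (simp add: vec_block_def)
      moreover have "0 \<cdot>\<^sub>v unit_vec s 0 = (0\<^sub>v s :: real vec)"
        by auto
      ultimately show "vec_block s l (?A *\<^sub>v z) = B *\<^sub>v vec_block s l z"
        using z that by (simp add: vec_block_block_mat[OF B])
    qed (auto simp: S_def vec_block_def)
    have "(?A ^\<^sub>m k) *\<^sub>v w \<in> S"
      using pow_mat_intertwine[OF A A, of S "\<lambda>v. v" w k] w inv Av by (auto simp: S_def)
    then have "(?A ^\<^sub>m k) *\<^sub>v w = 0\<^sub>v ?n"
      using blk by (intro vec_eq_0_blocks) (auto simp: S_def Bk vec_block_def)
    then show ?thesis
      by (simp only: w_def pow_mat_mult_vec_add[OF A v, of k "Suc k"])
  qed
  then show ?thesis
    by (rule nilpotent_matI[OF A])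
qed

lemma block_pattern_potentially_nilpotent:
  assumes m: "2 \<le> m" and sq: "square_mat \<N>" and s: "0 < dim_row \<N>"
    and nil: "potentially_nilpotent \<N>"
  shows "potentially_nilpotent (block_pattern m \<N>)"
proof -
  define s where "s = dim_row \<N>"
  have "0 < s" "dim_col \<N> = s"
    using s sq by (simp_all add: s_def)
  obtain B where BQ: "B \<in> Q \<N>" and nilB: "nilpotent_mat B"
    using nil unfolding potentially_nilpotent_def by blast
  have B: "B \<in> carrier_mat s s"
    using BQ \<open>dim_col \<N> = s\<close> by (simp add: Q_def s_def)
  \<comment> \<open>Nonzero weights with sum \<open>0\<close>: the first one balances the other \<open>m - 1\<close>, which are all \<open>1\<close>.\<close>
  define p :: "nat \<Rightarrow> real" where "p k = (if k = 0 then 1 - real m else 1)" for k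
  have "{..<m} = insert 0 {1..<m}"
    using m by auto
  then have p_sum: "(\<Sum>k<m. p k) = 0"
    using m by (simp add: p_def of_nat_diff)
  have p_nz: "p k \<noteq> 0" for k
    using m by (simp add: p_def)
  have "block_mat m p B $$ (i, j) \<noteq> 0 \<longleftrightarrow> block_pattern m \<N> $$ (i, j) = Star"
    if "i < m * s + 1" "j < m * s + 1" for i j
  proof -
    have "(i - 1) mod s < s" "(j - 1) mod s < s"
      using \<open>0 < s\<close> by simp_all
    then have "B $$ ((i - 1) mod s, (j - 1) mod s) \<noteq> 0
        \<longleftrightarrow> \<N> $$ ((i - 1) mod s, (j - 1) mod s) = Star"
      using BQ \<open>dim_col \<N> = s\<close> by (simp add: Q_def flip: s_def)
    then show ?thesis
      using that B p_nz
      by (cases "i = 0"; cases "j = 0") (simp_all add: block_mat_def block_pattern_def flip: s_def)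
  qed
  then have "block_mat m p B \<in> Q (block_pattern m \<N>)"
    using block_mat_carrier[OF B, of m p]
    by (simp add: Q_def block_pattern_def Let_def flip: s_def)
  moreover have "nilpotent_mat (block_mat m p B)"
    using B \<open>0 < s\<close> nilB p_sum by (rule nilpotent_block_mat)
  ultimately show ?thesis
    unfolding potentially_nilpotent_def by blast
qed

section \<open>Recursive star patterns\<close>

lemma recursive_star_pattern_square:
  "recursive_star_pattern \<A> \<Longrightarrow> square_mat \<A> \<and> 0 < dim_row \<A>"
  by (induction rule: recursive_star_pattern.induct)
    (auto simp: star_pattern_def block_pattern_def Let_def)

theorem theorem4p1:
  fixes \<A> :: pattern
  assumes "recursive_star_pattern \<A>"
  shows "potentially_nilpotent \<A>"
  using assms
proof (induction rule: recursive_star_pattern.induct)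
  case (star s)
  then show ?case by (rule star_pattern_potentially_nilpotent)
next
  case (block m \<N>)
  then show ?case
    using recursive_star_pattern_square[of \<N>] by (intro block_pattern_potentially_nilpotent) auto
qed

end
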